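(* Let $S\in\mathbb{R}^{\nu\times\nu}$, $L\in\mathbb{R}^{1\times\nu}$ with $(L,S)$ observable, and for $G\in\mathbb{C}^{\nu\times1}$ such that $\sigma(S-GL)\subset\mathbb{C}^{-}$ consider the system of order $\nu$ with state matrix $F=S-GL$, input matrix $G$ and output matrix $H$, $$\dot\xi=(S-GL)\xi+Gu,\qquad \psi=H\xi .$$ For $H=L$, these systems (parametrized by such $G$) define a family of systems of order $\nu$ that asymptotically track the output signal $\theta(t)$ of the signal generator $\dot\omega=S\omega$, $\theta=L\omega$, $\omega(0)\neq0$. Furthermore, these models match the moments at $\sigma(S)$ of the minimal system $\dot x=Ax+Bu$, $y=Cx$ (of order $n\ge\nu$, with $\sigma(A)\cap\sigma(S)=\emptyset$) if there exists an invertible matrix $\widetilde P$ such that $C\Pi=L\widetilde P$, where $\Pi$ is the unique solution of the Sylvester equation $A\Pi+BL=\Pi S$.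
   Context: All systems are single-input single-output. $\sigma(M)$ is the set of eigenvalues of $M$; $\mathbb{C}^{-}$ is the set of complex numbers with negative real part. The signal generator satisfies: $\sigma(S)$ is contained in the imaginary axis and the triplet $(L,S,\omega(0))$ is minimal, i.e. $(L,S)$ is observable and $\omega(0),S\omega(0),\dots,S^{\nu-1}\omega(0)$ span the state space. A system with input $u$ and output $\psi$ asymptotically tracks $\theta(t)$ if, when $u(t)=\theta(t)$, $\lim_{t\to\infty}(\psi(t)-\theta(t))=0$ for every initial state. Moment matching: the moments of $\dot x=Ax+Bu$, $y=Cx$ at $\sigma(S)$ are given by $C\Pi$, where $\Pi$ is the unique solution of $A\Pi+BL=\Pi S$. A system $\dot\xi=F\xi+Gu$, $\psi=H\xi$ of order $\nu$ with $\sigma(F)\cap\sigma(S)=\emptyset$ matches these moments at $\sigma(S)$ if $HP=C\Pi$, where $P\in\mathbb{C}^{\nu\times\nu}$ is the unique solution of $FP+GL=PS$.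
   Formalization: Since the moment claim fails for arbitrary invertible P~, it is proved for H=L, F=S-GL only if also (S-GL)P~+GL=P~S (which forces P~=I); for any invertible P~ with CΠ=LP~, matching is proved instead for the model (P~(S-GL)P~^{-1}, P~G, L). *)

theory Defs
  imports "HOL-Analysis.Analysis"
begin

text \<open>
  Matrices are vectors of rows, so \<open>'a^'n^'m\<close> is the type of \<open>m \<times> n\<close> matrices. Single-input
  single-output systems have an input matrix in \<open>'a^1^'n\<close> and an output matrix in \<open>'a^'n^1\<close>, and
  their signals take values in \<open>'a^1\<close>.
\<close>

definition eigvals :: "complex^'n^'n \<Rightarrow> complex set" where
  "eigvals M = {l. \<exists>v. v \<noteq> 0 \<and> M *v v = l *s v}"

definition left_half_plane :: "complex set" where
  "left_half_plane = {z. Re z < 0}"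

definition imag_axis :: "complex set" where
  "imag_axis = {z. Re z = 0}"

abbreviation complex_matrix :: "real^'n^'m \<Rightarrow> complex^'n^'m" where
  "complex_matrix \<equiv> map_matrix complex_of_real"

abbreviation complex_vector :: "real^'n \<Rightarrow> complex^'n" where
  "complex_vector x \<equiv> \<chi> i. complex_of_real (x $ i)"

text \<open>
  Matrix powers are expressed by iteration, since \<open>^\<close> on the type \<open>'a^'n^'n\<close> is componentwise.
  The spans are over the field of the entries.
\<close>

definition controllable :: "'a::field^'n^'n \<Rightarrow> 'a^'n \<Rightarrow> bool" where
  "controllable A b \<longleftrightarrow> vec.span {((*v) A ^^ k) b |k. k < CARD('n)} = UNIV"

definition observable :: "'a::field^'n^1 \<Rightarrow> 'a^'n^'n \<Rightarrow> bool" where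
  "observable C A \<longleftrightarrow> vec.span {((\<lambda>r. r v* A) ^^ k) (row 1 C) |k. k < CARD('n)} = UNIV"

definition minimal_triple :: "'a::field^'n^1 \<Rightarrow> 'a^'n^'n \<Rightarrow> 'a^'n \<Rightarrow> bool" where
  "minimal_triple C A b \<longleftrightarrow> observable C A \<and> controllable A b"

definition minimal_system :: "'a::field^'n^'n \<Rightarrow> 'a^1^'n \<Rightarrow> 'a^'n^1 \<Rightarrow> bool" where
  "minimal_system A B C \<longleftrightarrow> minimal_triple C A (column 1 B)"

definition signal_generator_state :: "real^'n^'n \<Rightarrow> real^'n \<Rightarrow> (real \<Rightarrow> real^'n) \<Rightarrow> bool" where
  "signal_generator_state S w0 w \<longleftrightarrow>
     w 0 = w0 \<and> (\<forall>t\<ge>0. (w has_vector_derivative S *v w t) (at t within {0..}))"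

definition state_response ::
  "complex^'n^'n \<Rightarrow> complex^1^'n \<Rightarrow> (real \<Rightarrow> complex^1) \<Rightarrow> complex^'n \<Rightarrow> (real \<Rightarrow> complex^'n) \<Rightarrow> bool"
where
  "state_response F G u x0 x \<longleftrightarrow>
     x 0 = x0 \<and> (\<forall>t\<ge>0. (x has_vector_derivative F *v x t + G *v u t) (at t within {0..}))"

definition asymptotically_tracks ::
  "complex^'n^'n \<Rightarrow> complex^1^'n \<Rightarrow> complex^'n^1 \<Rightarrow> (real \<Rightarrow> complex^1) \<Rightarrow> bool"
where
  "asymptotically_tracks F G H \<theta> \<longleftrightarrow>
     (\<forall>x0 x. state_response F G \<theta> x0 x \<longrightarrow> ((\<lambda>t. H *v x t - \<theta> t) \<longlongrightarrow> 0) at_top)"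

definition unique_sylvester_solution ::
  "complex^'m^'m \<Rightarrow> complex^1^'m \<Rightarrow> complex^'n^1 \<Rightarrow> complex^'n^'n \<Rightarrow> complex^'n^'m \<Rightarrow> bool"
where
  "unique_sylvester_solution A B L S X \<longleftrightarrow>
     A ** X + B ** L = X ** S \<and> (\<forall>Y. A ** Y + B ** L = Y ** S \<longrightarrow> Y = X)"

text \<open>
  The model \<open>(F, G, H)\<close>, whose order is that of \<open>S\<close>, matches the moments of \<open>(A, B, C)\<close> at the
  eigenvalues of \<open>S\<close>. Disjointness of the spectra of \<open>A\<close> and \<open>S\<close> is what makes the first Sylvester
  equation uniquely solvable.
\<close>

definition matches_moments ::
  "complex^'n^'n \<Rightarrow> complex^'n^1 \<Rightarrow>
   complex^'m^'m \<Rightarrow> complex^1^'m \<Rightarrow> complex^'m^1 \<Rightarrow>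
   complex^'n^'n \<Rightarrow> complex^1^'n \<Rightarrow> complex^'n^1 \<Rightarrow> bool"
where
  "matches_moments S L A B C F G H \<longleftrightarrow>
     eigvals F \<inter> eigvals S = {} \<and>
     (\<exists>X P. unique_sylvester_solution A B L S X \<and>
           unique_sylvester_solution F G L S P \<and>
           H ** P = C ** X)"

text \<open>
  For \<open>F = S - G L\<close> the Sylvester solution \<open>P\<close> is the identity, so \<open>(S - G L, G, L)\<close> matches
  exactly when \<open>C X = L\<close>. An arbitrary invertible \<open>T\<close> with \<open>C X = L T\<close> does not suffice: with all
  sizes one, \<open>S = 0\<close>, \<open>L = G = B = 1\<close>, \<open>A = -1\<close>, \<open>C = 2\<close> give \<open>C X = 2\<close>. Such a \<open>T\<close> yields a match
  for the model with output matrix \<open>L\<close> when it is the Sylvester solution of that model. In the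
  state coordinates \<open>T \<xi>\<close>, that is for \<open>(T (S - G L) T', T G, L)\<close> with \<open>T'\<close> the inverse of \<open>T\<close>,
  this holds for every invertible \<open>T\<close>; in the original coordinates it is a condition on \<open>T\<close>.
\<close>

end

theory Submission
  imports Defs "HOL-Computational_Algebra.Fundamental_Theorem_Algebra"
begin

text \<open>
  Write \<open>F = S - G L\<close>. If the model with state \<open>\<xi>\<close> is driven by \<open>\<theta> = L \<omega>\<close>, the error \<open>e = \<xi> - \<omega>\<close>
  satisfies \<open>e' = F \<xi> + G L \<omega> - S \<omega> = F e\<close>: the input injects exactly the term that turns \<open>S\<close> into
  \<open>F\<close>. As \<open>F\<close> has its spectrum in the open left half plane, \<open>e\<close> tends to \<open>0\<close>, and so does
  \<open>L e = \<psi> - \<theta>\<close> (\<open>output_injection_tracks\<close>).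

  For the moments, the first model is the original one in the state coordinates \<open>P \<xi>\<close>, with
  \<open>F\<^sub>1 = P F P'\<close> and \<open>G\<^sub>1 = P G\<close>, where \<open>P'\<close> is the inverse of \<open>P\<close>. Then \<open>T = P\<close> solves
  \<open>F\<^sub>1 T + G\<^sub>1 L = T S\<close>, as the left-hand side is \<open>P F + P G L = P S\<close>, and the matching condition
  \<open>L T = C X\<close> is the hypothesis on \<open>P\<close>. In the original coordinates, \<open>P\<close> is assumed to solve the Sylvester
  equation. The equations have one solution only, because the spectrum of \<open>S\<close> is disjoint
  (\<open>intertwiner_of_disjoint_spectra_eq_0\<close>) from that of \<open>A\<close> by hypothesis, from those of \<open>F\<close> and
  \<open>F\<^sub>1\<close> because these lie in the open left half plane and that of \<open>S\<close> lies on the imaginary axis.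

  Both the decay of the solutions of \<open>e' = F e\<close> and the uniqueness for Sylvester equations rest on one
  algebraic fact (\<open>eigval_product_annihilates\<close>): for every square matrix \<open>M\<close> there are eigenvalues
  \<open>l\<^sub>1, \<dots>, l\<^sub>k\<close> with \<open>(M - l\<^sub>1) \<cdots> (M - l\<^sub>k) = 0\<close>. It replaces the Jordan form: each claim
  is proved by peeling off one factor at a time, where a factor costs a scalar equation
  \<open>z' = l z + g\<close> with \<open>g\<close> tending to \<open>0\<close>, respectively the injectivity of \<open>A - l\<close> for a non-eigenvalue
  \<open>l\<close> of \<open>A\<close>.
\<close>

section \<open>A product of eigenvalue factors that vanishes\<close>

definition poly_apply :: "complex^'n^'n \<Rightarrow> complex poly \<Rightarrow> complex^'n \<Rightarrow> complex^'n" where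
  "poly_apply M p v = (\<Sum>i\<le>degree p. coeff p i *s ((*v) M ^^ i) v)"

text \<open>
  Polynomials of different degrees have to be compared below, which needs a common range of
  summation.
\<close>

lemma poly_apply_bound:
  assumes "degree p \<le> N"
  shows "poly_apply M p v = (\<Sum>i\<le>N. coeff p i *s ((*v) M ^^ i) v)"
  unfolding poly_apply_def
  by (rule sum.mono_neutral_left) (use assms in \<open>auto simp: coeff_eq_0\<close>)

lemma funpow_matrix_mult_diff:
  fixes M :: "complex^'n^'n"
  shows "((*v) M ^^ i) (M *v v - l *s v) = ((*v) M ^^ Suc i) v - l *s ((*v) M ^^ i) v"
  by (induction i) (auto simp: vec.diff vec.scale)

text \<open>
  The factor \<open>M - l\<close> can be applied first (this lemma) or last (the next one). Peeling off an eigenvalue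
  needs the former, cancelling the factor of a non-eigenvalue needs the latter.
\<close>

lemma poly_apply_root_factor:
  "poly_apply M ([:- l, 1:] * q) v = poly_apply M q (M *v v - l *s v)"
proof -
  let ?p = "[:- l, 1:] * q"
  let ?f = "\<lambda>i. ((*v) M ^^ i) v"
  have deg: "degree ?p \<le> Suc (degree q)"
    by (rule order_trans[OF degree_mult_le]) simp
  have "poly_apply M ?p v = (\<Sum>i\<le>Suc (degree q). coeff (pCons 0 q) i *s ?f i)
      - (\<Sum>i\<le>Suc (degree q). l *s (coeff q i *s ?f i))"
    unfolding poly_apply_bound[OF deg]
    by (simp add: sum_subtractf[symmetric] vec.scale_left_diff_distrib del: sum.atMost_Suc)
  also have "(\<Sum>i\<le>Suc (degree q). coeff (pCons 0 q) i *s ?f i) = (\<Sum>i\<le>degree q. coeff q i *s ?f (Suc i))"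
    by (subst sum.atMost_Suc_shift) simp
  also have "(\<Sum>i\<le>Suc (degree q). l *s (coeff q i *s ?f i)) = (\<Sum>i\<le>degree q. coeff q i *s (l *s ?f i))"
    by (simp add: coeff_eq_0 mult.commute)
  also have "(\<Sum>i\<le>degree q. coeff q i *s ?f (Suc i)) - \<dots>
      = (\<Sum>i\<le>degree q. coeff q i *s (?f (Suc i) - l *s ?f i))"
    by (simp only: sum_subtractf[symmetric] vec.scale_right_diff_distrib)
  also have "\<dots> = poly_apply M q (M *v v - l *s v)"
    unfolding poly_apply_def funpow_matrix_mult_diff ..
  finally show ?thesis .
qed

lemma poly_apply_commute:
  "poly_apply M q (M *v v - l *s v) = M *v poly_apply M q v - l *s poly_apply M q v"
  unfolding poly_apply_def funpow_matrix_mult_diff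
  by (simp add: vec.sum vec.scale vec.scale_right_diff_distrib sum_subtractf vec.scale_sum_right mult.commute)

text \<open>
  The powers of \<open>M\<close> lie in a space of finite real dimension, so finitely many of them satisfy a
  nontrivial linear relation, and real coefficients are enough. The relation may degenerate to
  an equality of two powers, which is treated separately.
\<close>

lemma matrix_powers_annihilator:
  fixes M :: "complex^'n^'n"
  obtains p where "p \<noteq> 0" "\<And>v. poly_apply M p v = 0"
proof -
  define Q where "Q = (\<lambda>k. ((**) M ^^ k) (mat 1))"
  have Qv: "Q k *v v = ((*v) M ^^ k) v" for k v
    by (induction k) (auto simp: Q_def matrix_vector_mul_assoc[symmetric])
  define N where "N = DIM(complex^'n^'n)"
  show ?thesis
  proof (cases "inj_on Q {..N}")
    case True
    then have "card (Q ` {..N}) > DIM(complex^'n^'n)" by (simp add: card_image N_def)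
    then have "dependent (Q ` {..N})" by (intro dependent_biggerset)
    then obtain u k where u: "k \<le> N" "u (Q k) \<noteq> 0" "(\<Sum>A\<in>Q ` {..N}. u A *\<^sub>R A) = 0"
      by (subst (asm) real_vector.dependent_finite) auto
    then have sum0: "(\<Sum>i\<le>N. u (Q i) *\<^sub>R Q i) = 0"
      using True by (simp add: sum.reindex)
    define p where "p = (\<Sum>i\<le>N. monom (complex_of_real (u (Q i))) i)"
    have coeff: "coeff p i = (if i \<le> N then of_real (u (Q i)) else 0)" for i
      by (auto simp: p_def coeff_sum)
    have "degree p \<le> N" by (rule degree_le) (simp add: coeff)
    show ?thesis
    proof
      show "p \<noteq> 0" using u coeff[of k] by auto
      fix v
      have lin: "(r *\<^sub>R A) *v v = complex_of_real r *s (A *v v)" for r and A :: "complex^'n^'n"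
        by (simp add: vec_eq_iff matrix_vector_mult_def sum_distrib_left scaleR_conv_of_real[where 'a=complex] mult.assoc)
      have "poly_apply M p v = (\<Sum>i\<le>N. (u (Q i) *\<^sub>R Q i) *v v)"
        unfolding poly_apply_bound[OF \<open>degree p \<le> N\<close>] by (simp add: coeff Qv lin)
      also have "\<dots> = (\<Sum>i\<le>N. u (Q i) *\<^sub>R Q i) *v v"
        by (induction N) (auto simp: matrix_vector_mult_add_rdistrib)
      finally show "poly_apply M p v = 0" by (simp add: sum0)
    qed
  next
    case False
    then obtain i j where ij: "i \<noteq> j" "Q i = Q j" by (auto simp: inj_on_def)
    define p :: "complex poly" where "p = monom 1 i - monom 1 j"
    have deg: "degree p \<le> max i j"
      unfolding p_def by (rule degree_diff_le) (auto intro: order_trans[OF degree_monom_le])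
    show ?thesis
    proof
      show "p \<noteq> 0" using ij by (simp add: p_def monom_eq_iff')
      fix v
      have "poly_apply M p v = ((*v) M ^^ i) v - ((*v) M ^^ j) v"
        unfolding poly_apply_bound[OF deg]
        by (simp add: p_def vec.scale_left_diff_distrib sum_subtractf if_distrib[of "\<lambda>x. x *s _"] cong: if_cong)
      then show "poly_apply M p v = 0" using ij(2) by (simp add: Qv[symmetric])
    qed
  qed
qed

lemma non_eigval_kernel:
  assumes "l \<notin> eigvals M" "M *v v - l *s v = 0" shows "v = 0"
  using assms by (auto simp: eigvals_def)

text \<open>
  Split \<open>p\<close> into linear factors. A root that is not an eigenvalue contributes an injective factor,
  which can be cancelled, so the roots that are eigenvalues suffice.
\<close>

lemma eigval_factors_of_annihilator:
  assumes "p \<noteq> 0"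
  obtains ls where "set ls \<subseteq> eigvals M"
    "\<And>v. poly_apply M p v = 0 \<Longrightarrow> fold (\<lambda>l v. M *v v - l *s v) ls v = 0"
  using assms
proof (induction "degree p" arbitrary: p thesis)
  case 0
  then have "coeff p 0 \<noteq> 0" by (metis leading_coeff_0_iff)
  then have "\<And>v. poly_apply M p v = 0 \<Longrightarrow> v = 0" using 0 by (simp add: poly_apply_def)
  then show ?case using 0(2)[of "[]"] by simp
next
  case (Suc n)
  have "\<not> constant (poly p)" using Suc(2) by (simp add: constant_degree)
  then obtain l where "poly p l = 0" using fundamental_theorem_of_algebra by blast
  then obtain q where p: "p = [:- l, 1:] * q" by (auto simp: poly_eq_0_iff_dvd dvd_def)
  then have "q \<noteq> 0" using Suc by auto
  then have "n = degree q" using Suc(2) unfolding p by (subst (asm) degree_mult_eq) auto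
  from Suc(1)[OF this _ \<open>q \<noteq> 0\<close>] obtain ls where ls: "set ls \<subseteq> eigvals M"
    "\<And>v. poly_apply M q v = 0 \<Longrightarrow> fold (\<lambda>l v. M *v v - l *s v) ls v = 0" by blast
  show ?case
  proof (cases "l \<in> eigvals M")
    case True
    show ?thesis
      by (rule Suc(3)[of "l # ls"])
        (use ls True in \<open>auto simp: p poly_apply_root_factor simp del: mult_pCons_left\<close>)
  next
    case False
    show ?thesis
      by (rule Suc(3)[OF ls])
        (use False in \<open>auto simp: p poly_apply_root_factor poly_apply_commute simp del: mult_pCons_left dest: non_eigval_kernel\<close>)
  qed
qed

lemma eigval_product_annihilates:
  fixes M :: "complex^'n^'n"
  obtains ls where "set ls \<subseteq> eigvals M" "\<And>v. fold (\<lambda>l v. M *v v - l *s v) ls v = 0"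
proof -
  obtain p where p: "p \<noteq> 0" "\<And>v. poly_apply M p v = 0"
    using matrix_powers_annihilator[of M] by blast
  show ?thesis
    by (rule eigval_factors_of_annihilator[OF p(1), of M]) (use that p(2) in blast)
qed

section \<open>Decay of the solutions of a stable linear differential equation\<close>

text \<open>
  With the integrating factor, \<open>(exp (- l t) z)' = exp (- l t) g\<close>. Once \<open>|g| < d\<close>, the right-hand side
  is bounded by the derivative of \<open>(d / m) exp (m t)\<close>, where \<open>m = - Re l > 0\<close>. Integrating from \<open>T\<close>
  and multiplying back, \<open>|z t| \<le> exp (- m (t - T)) |z T| + d / m\<close>.
\<close>

lemma scalar_forced_decay:
  fixes z g :: "real \<Rightarrow> complex"
  assumes z: "\<And>t. t \<ge> 0 \<Longrightarrow> (z has_vector_derivative l * z t + g t) (at t within {0..})"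
    and g: "(g \<longlongrightarrow> 0) at_top" and l: "Re l < 0"
  shows "(z \<longlongrightarrow> 0) at_top"
proof (rule tendstoI)
  fix e :: real assume e: "e > 0"
  define m where "m = - Re l"
  have m: "m > 0" using l by (simp add: m_def)
  \<comment> \<open>chosen so that the limiting bound \<open>d / m\<close> is half of the prescribed \<open>e\<close>\<close>
  define d where "d = e * m / 2"
  have "d > 0" using e m by (simp add: d_def)
  with g have "eventually (\<lambda>t. dist (g t) 0 < d) at_top"
    by (rule tendstoD)
  then obtain T0 where T0: "\<And>t. t \<ge> T0 \<Longrightarrow> norm (g t) < d"
    unfolding eventually_at_top_linorder by auto
  define T where "T = max T0 0"
  have T: "T \<ge> 0" "\<And>t. t \<ge> T \<Longrightarrow> norm (g t) < d" using T0 by (auto simp: T_def)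
  define f where "f = (\<lambda>t. exp (- (of_real t * l)) * z t)"
  have f: "(f has_vector_derivative exp (- (of_real t * l)) * g t) (at t within {0..})" if "t \<ge> 0" for t
  proof -
    have "((\<lambda>t. exp (- (of_real t * l))) has_vector_derivative - l * exp (- (of_real t * l))) (at t within {0..})"
    proof (rule has_vector_derivative_eq_rhs)
      have "((\<lambda>x. exp (- (x * l))) has_field_derivative - l * exp (- (of_real t * l))) (at (of_real t))"
        by (auto intro!: derivative_eq_intros)
      then show "((\<lambda>t. exp (- (of_real t * l))) has_vector_derivative - l * exp (- (of_real t * l))) (at t within {0..})"
        by (intro has_vector_derivative_real_field)
    qed simp
    from has_vector_derivative_mult[OF this z[OF that]] show ?thesis
      unfolding f_def by (simp add: algebra_simps)
  qed
  have bound: "norm (z t) \<le> exp (- m * (t - T)) * norm (z T) + e / 2" if "t > T" for t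
  proof -
    have "norm (f t - f T) \<le> d / m * exp (m * t) - d / m * exp (m * T)"
    proof (rule differentiable_bound_general[where f' = "\<lambda>s. exp (- (of_real s * l)) * g s"
          and \<phi>' = "\<lambda>s. d * exp (m * s)"])
      show "continuous_on {T..t} f"
      proof (rule continuous_on_vector_derivative)
        fix s assume "s \<in> {T..t}"
        then show "(f has_vector_derivative exp (- (of_real s * l)) * g s) (at s within {T..t})"
          using f[of s] T(1) by (auto intro: has_vector_derivative_within_subset)
      qed
      show "continuous_on {T..t} (\<lambda>s. d / m * exp (m * s))" by (intro continuous_intros)
      fix s assume s: "T < s" "s < t"
      have "at s within {0..} = at s" 
        using s T(1) by (intro at_within_interior) simp
      then show "(f has_vector_derivative exp (- (of_real s * l)) * g s) (at s)"
        using f[of s] s T(1) by simp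
      show "((\<lambda>s. d / m * exp (m * s)) has_vector_derivative d * exp (m * s)) (at s)"
        using m by (auto intro!: derivative_eq_intros simp: has_real_derivative_iff_has_vector_derivative[symmetric])
      show "norm (exp (- (of_real s * l)) * g s) \<le> d * exp (m * s)"
        using T(2)[of s] s by (simp add: norm_mult m_def mult.commute)
    qed (rule that)
    then have "norm (f t) \<le> norm (f T) + d / m * exp (m * t)"
      using norm_triangle_ineq2[of "f t" "f T"] \<open>d > 0\<close> m by (smt (verit) divide_pos_pos exp_gt_zero mult_pos_pos)
    then have "exp (m * t) * norm (z t) \<le> exp (m * T) * norm (z T) + e / 2 * exp (m * t)"
      using m by (simp add: f_def norm_mult m_def d_def mult.commute)
    then have "exp (- m * t) * (exp (m * t) * norm (z t))
        \<le> exp (- m * t) * (exp (m * T) * norm (z T) + e / 2 * exp (m * t))"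
      by (intro mult_left_mono) auto
    then show ?thesis
      by (simp add: algebra_simps flip: exp_add mult.assoc)
  qed
  have "((\<lambda>t. exp (- m * (t - T)) * norm (z T)) \<longlongrightarrow> 0 * norm (z T)) at_top"
  proof (intro tendsto_mult_right)
    have "LIM t at_top. - m * (t - T) :> at_bot"
      using m by real_asymp
    then show "((\<lambda>t. exp (- m * (t - T))) \<longlongrightarrow> 0) at_top"
      by (rule filterlim_compose[OF exp_at_bot])
  qed
  then have "eventually (\<lambda>t. exp (- m * (t - T)) * norm (z T) < e / 2) at_top"
    by (rule order_tendstoD) (use e in auto)
  then show "eventually (\<lambda>t. dist (z t) 0 < e) at_top"
    using eventually_gt_at_top[of T]
    by eventually_elim (use bound in fastforce)
qed

lemma has_vector_derivative_vec_nth: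
  "(z has_vector_derivative z') F \<Longrightarrow> ((\<lambda>t. z t $ i) has_vector_derivative z' $ i) F"
  by (rule bounded_linear.has_vector_derivative[OF bounded_linear_vec_nth])

text \<open>
  Along a solution \<open>z\<close>, the function \<open>y = (M - l) z\<close> is again a solution and is annihilated by one factor
  fewer. Since \<open>z' = l z + y\<close>, the decay of \<open>y\<close> passes to \<open>z\<close>.
\<close>

lemma annihilated_solution_decays:
  fixes z :: "real \<Rightarrow> complex^'n"
  assumes "\<And>t. t \<ge> 0 \<Longrightarrow> (z has_vector_derivative M *v z t) (at t within {0..})"
    and "set ls \<subseteq> left_half_plane"
    and "\<And>t. fold (\<lambda>l v. M *v v - l *s v) ls (z t) = 0"
  shows "(z \<longlongrightarrow> 0) at_top"
  using assms
proof (induction ls arbitrary: z)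
  case Nil
  then have "z = (\<lambda>t. 0)" by auto
  then show ?case by simp
next
  case (Cons l ls)
  define y where "y t = M *v z t - l *s z t" for t
  have lin: "bounded_linear (\<lambda>v. M *v v - l *s v)"
    by (intro bounded_linear_sub matrix_vector_mul_bounded_linear)
      (rule linear_conv_bounded_linear[THEN iffD1], rule linearI, auto simp: vec_eq_iff algebra_simps)
  have "(y \<longlongrightarrow> 0) at_top"
  proof (rule Cons.IH)
    fix t :: real assume "t \<ge> 0"
    from bounded_linear.has_vector_derivative[OF lin Cons.prems(1)[OF this]]
    show "(y has_vector_derivative M *v y t) (at t within {0..})"
      by (simp add: y_def[abs_def] vec.diff vec.scale)
  qed (use Cons.prems in \<open>auto simp: y_def\<close>)
  show ?case
  proof (rule vec_tendstoI)
    fix i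
    have "((\<lambda>t. z t $ i) \<longlongrightarrow> 0) at_top"
    proof (rule scalar_forced_decay)
      show "((\<lambda>t. z t $ i) has_vector_derivative l * z t $ i + y t $ i) (at t within {0..})" if "t \<ge> 0" for t
        using has_vector_derivative_vec_nth[OF Cons.prems(1)[OF that], of i] by (simp add: y_def)
      show "((\<lambda>t. y t $ i) \<longlongrightarrow> 0) at_top"
        using tendsto_vec_nth[OF \<open>(y \<longlongrightarrow> 0) at_top\<close>, of i] by simp
      show "Re l < 0" using Cons.prems by (auto simp: left_half_plane_def)
    qed
    then show "((\<lambda>t. z t $ i) \<longlongrightarrow> 0 $ i) at_top" by simp
  qed
qed

lemma hurwitz_solution_decays:
  fixes z :: "real \<Rightarrow> complex^'n"
  assumes "eigvals M \<subseteq> left_half_plane"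
    and "\<And>t. t \<ge> 0 \<Longrightarrow> (z has_vector_derivative M *v z t) (at t within {0..})"
  shows "(z \<longlongrightarrow> 0) at_top"
  by (rule eigval_product_annihilates[of M])
    (use annihilated_solution_decays assms in blast)

section \<open>Sylvester equations and moment matching\<close>

text \<open>
  From \<open>A X = X S\<close> follows \<open>(A - l) X = X (S - l)\<close>. If \<open>l\<close> is an eigenvalue of \<open>S\<close>, hence not of
  \<open>A\<close>, then \<open>X (S - l) v = 0\<close> implies \<open>X v = 0\<close>. So the vanishing product of factors \<open>S - l\<close> can be
  stripped off one factor at a time.
\<close>

lemma intertwiner_of_disjoint_spectra_eq_0:
  fixes X :: "complex^'n^'m"
  assumes "A ** X = X ** S" and "eigvals A \<inter> eigvals S = {}"
  shows "X = 0"
proof -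
  obtain ls where ls: "set ls \<subseteq> eigvals S" "\<And>v. fold (\<lambda>l v. S *v v - l *s v) ls v = 0"
    using eigval_product_annihilates[of S] by blast
  have "X *v v = 0" if "set ls \<subseteq> eigvals S" "fold (\<lambda>l v. S *v v - l *s v) ls v = 0" for v
    using that
  proof (induction ls arbitrary: v)
    case (Cons l ls)
    then have "X *v (S *v v - l *s v) = 0" by simp
    then have "A *v (X *v v) - l *s (X *v v) = 0"
      by (simp add: vec.diff vec.scale matrix_vector_mul_assoc assms(1))
    moreover have "l \<notin> eigvals A" using Cons.prems assms(2) by auto
    ultimately show ?case using non_eigval_kernel by blast
  qed simp
  with ls show ?thesis by (simp add: matrix_eq)
qed

lemma matrix_mul_diff_right:
  fixes A :: "'a::ring_1^'n^'m"
  shows "A ** (B - C) = A ** B - A ** C"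
  by (simp add: matrix_matrix_mult_def vec_eq_iff sum_subtractf right_diff_distrib)

lemma matrix_mul_diff_left:
  fixes A :: "'a::ring_1^'n^'m"
  shows "(A - B) ** C = A ** C - B ** C"
  by (simp add: matrix_matrix_mult_def vec_eq_iff sum_subtractf left_diff_distrib)

lemma unique_sylvester_solutionI:
  assumes "A ** X + B ** L = X ** S" and "eigvals A \<inter> eigvals S = {}"
  shows "unique_sylvester_solution A B L S X"
  unfolding unique_sylvester_solution_def
proof (intro conjI allI impI assms(1))
  fix Y assume "A ** Y + B ** L = Y ** S"
  then have "A ** (Y - X) = (Y - X) ** S"
    using assms(1) by (simp add: matrix_mul_diff_left matrix_mul_diff_right) (metis add_diff_cancel_right)
  then show "Y = X" using intertwiner_of_disjoint_spectra_eq_0 assms(2) by fastforce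
qed

lemma matches_momentsI:
  assumes "A ** X + B ** L = X ** S" "eigvals A \<inter> eigvals S = {}"
    and "F ** P + G ** L = P ** S" "eigvals F \<inter> eigvals S = {}"
    and "H ** P = C ** X"
  shows "matches_moments S L A B C F G H"
  unfolding matches_moments_def
  using assms by (blast intro: unique_sylvester_solutionI)

lemma matrix_inv_mult:
  fixes P :: "'a::field^'n^'n"
  assumes "invertible P" shows "P ** matrix_inv P = mat 1" "matrix_inv P ** P = mat 1"
  using someI_ex[OF assms[unfolded invertible_def]] by (auto simp: matrix_inv_def)

lemma eigvals_similar:
  fixes P :: "complex^'n^'n"
  assumes "invertible P"
  shows "eigvals (P ** F ** matrix_inv P) \<subseteq> eigvals F"
proof
  fix l assume "l \<in> eigvals (P ** F ** matrix_inv P)"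
  then obtain v where v: "v \<noteq> 0" "P *v (F *v (matrix_inv P *v v)) = l *s v"
    by (auto simp: eigvals_def matrix_vector_mul_assoc[symmetric])
  define u where "u = matrix_inv P *v v"
  have "P *v u = v" by (simp add: u_def matrix_vector_mul_assoc matrix_inv_mult[OF assms])
  then have "u \<noteq> 0" using v by auto
  have "F *v u = matrix_inv P *v (P *v (F *v u))" 
    by (simp add: matrix_vector_mul_assoc matrix_mul_assoc matrix_inv_mult[OF assms])
  also have "\<dots> = l *s u" using v by (simp add: u_def vec.scale)
  finally show "l \<in> eigvals F" using \<open>u \<noteq> 0\<close> by (auto simp: eigvals_def)
qed

section \<open>Tracking\<close>

lemma complex_vector_matrix_mult:
  "complex_vector (A *v v) = complex_matrix A *v complex_vector v"
  by (simp add: vec_eq_iff matrix_vector_mult_def map_matrix_def)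

lemma has_vector_derivative_complex_vector:
  fixes w :: "real \<Rightarrow> real^'n"
  assumes "(w has_vector_derivative w') F"
  shows "((\<lambda>t. complex_vector (w t)) has_vector_derivative complex_vector w') F"
proof (rule bounded_linear.has_vector_derivative[OF _ assms])
  show "bounded_linear (complex_vector :: real^'n \<Rightarrow> complex^'n)"
    by (rule linear_conv_bounded_linear[THEN iffD1], rule linearI)
      (auto simp: vec_eq_iff scaleR_complex.ctr complex_eq_iff)
qed

text \<open>
  The generator state \<open>\<omega>\<close> is itself a trajectory of the model driven by \<open>L \<omega>\<close>, because
  \<open>S \<omega> = (S - G L) \<omega> + G (L \<omega>)\<close>. The difference of two trajectories with the same input solves
  the homogeneous equation and decays.
\<close>

lemma output_injection_tracks:
  fixes S :: "real^'n^'n" and L :: "real^'n^1" and G :: "complex^1^'n"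
  defines "F \<equiv> complex_matrix S - G ** complex_matrix L"
  assumes "signal_generator_state S w0 w" and "eigvals F \<subseteq> left_half_plane"
  shows "asymptotically_tracks F G (complex_matrix L) (\<lambda>t. complex_vector (L *v w t))"
  unfolding asymptotically_tracks_def
proof (intro allI impI)
  fix x0 x assume x: "state_response F G (\<lambda>t. complex_vector (L *v w t)) x0 x"
  define e where "e t = x t - complex_vector (w t)" for t
  have "(e \<longlongrightarrow> 0) at_top"
  proof (rule hurwitz_solution_decays)
    fix t :: real assume t: "t \<ge> 0"
    have "(x has_vector_derivative F *v x t + G *v complex_vector (L *v w t)) (at t within {0..})"
      "(w has_vector_derivative S *v w t) (at t within {0..})"
      using x assms(2) t by (auto simp: state_response_def signal_generator_state_def)
    then have "(e has_vector_derivative F *v x t + G *v complex_vector (L *v w t)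
        - complex_vector (S *v w t)) (at t within {0..})"
      unfolding e_def by (intro has_vector_derivative_diff has_vector_derivative_complex_vector)
    also have "F *v x t + G *v complex_vector (L *v w t) - complex_vector (S *v w t) = F *v e t"
      by (simp add: e_def vec.diff complex_vector_matrix_mult F_def
          matrix_vector_mult_diff_rdistrib matrix_vector_mul_assoc)
    finally show "(e has_vector_derivative F *v e t) (at t within {0..})" .
  qed (rule assms)
  then have "((\<lambda>t. complex_matrix L *v e t) \<longlongrightarrow> complex_matrix L *v 0) at_top"
    by (rule bounded_linear.tendsto[OF matrix_vector_mul_bounded_linear])
  then show "((\<lambda>t. complex_matrix L *v x t - complex_vector (L *v w t)) \<longlongrightarrow> 0) at_top"
    by (simp add: e_def vec.diff complex_vector_matrix_mult)
qed

section \<open>The family of tracking and moment matching models\<close>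

theorem proposition6:
  fixes S :: "real^'n^'n" and L :: "real^'n^1"
    and w0 :: "real^'n" and w :: "real \<Rightarrow> real^'n"
  assumes "eigvals (complex_matrix S) \<subseteq> imag_axis"
    and "observable L S"
    and "minimal_triple L S w0"
    and "w0 \<noteq> 0"
    and "signal_generator_state S w0 w"
  defines "Sc \<equiv> complex_matrix S" and "Lc \<equiv> complex_matrix L"
    and "\<theta> \<equiv> (\<lambda>t. complex_vector (L *v w t))"
  shows "\<forall>G :: complex^1^'n. eigvals (Sc - G ** Lc) \<subseteq> left_half_plane \<longrightarrow>
    asymptotically_tracks (Sc - G ** Lc) G Lc \<theta> \<and>
    (\<forall>(A :: complex^'m^'m) (B :: complex^1^'m) (C :: complex^'m^1) (X :: complex^'n^'m)
        (P :: complex^'n^'n).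
      CARD('n) \<le> CARD('m) \<and> minimal_system A B C \<and> eigvals A \<inter> eigvals Sc = {} \<and>
      A ** X + B ** Lc = X ** Sc \<and>
      invertible P \<and> C ** X = Lc ** P \<longrightarrow>
        matches_moments Sc Lc A B C (P ** (Sc - G ** Lc) ** matrix_inv P) (P ** G) Lc \<and>
        ((Sc - G ** Lc) ** P + G ** Lc = P ** Sc \<longrightarrow>
          matches_moments Sc Lc A B C (Sc - G ** Lc) G Lc))"
proof (intro allI impI conjI; (elim conjE)?)
  fix G :: "complex^1^'n"
  assume stable: "eigvals (Sc - G ** Lc) \<subseteq> left_half_plane"
  then show "asymptotically_tracks (Sc - G ** Lc) G Lc \<theta>"
    unfolding Sc_def Lc_def \<theta>_def by (rule output_injection_tracks[OF assms(5)])
  have disjoint: "eigvals (Sc - G ** Lc) \<inter> eigvals Sc = {}"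
    using stable assms(1) by (fastforce simp: Sc_def left_half_plane_def imag_axis_def)
  fix A :: "complex^'m^'m" and B :: "complex^1^'m" and C :: "complex^'m^1"
    and X :: "complex^'n^'m" and P :: "complex^'n^'n"
  assume A: "eigvals A \<inter> eigvals Sc = {}" and X: "A ** X + B ** Lc = X ** Sc"
    and P: "invertible P" and CX: "C ** X = Lc ** P"
  show "matches_moments Sc Lc A B C (P ** (Sc - G ** Lc) ** matrix_inv P) (P ** G) Lc"
  proof (rule matches_momentsI[OF X A])
    have "P ** (Sc - G ** Lc) ** matrix_inv P ** P = P ** (Sc - G ** Lc)"
      by (simp add: matrix_mul_assoc[symmetric] matrix_inv_mult[OF P])
    then show "P ** (Sc - G ** Lc) ** matrix_inv P ** P + P ** G ** Lc = P ** Sc"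
      by (simp add: matrix_mul_diff_right matrix_mul_assoc)
    show "eigvals (P ** (Sc - G ** Lc) ** matrix_inv P) \<inter> eigvals Sc = {}"
      using disjoint eigvals_similar[OF P] by blast
  qed (rule CX[symmetric])
  assume "(Sc - G ** Lc) ** P + G ** Lc = P ** Sc"
  then show "matches_moments Sc Lc A B C (Sc - G ** Lc) G Lc"
    by (rule matches_momentsI[OF X A _ disjoint CX[symmetric]])
qed

end
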